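(* For every D3-reducible graph $G$ and every edge $uv$ of $G$, the graph $G-uv$ obtained by deleting the edge $uv$ is not 3-vertex-connected.
   Context: All graphs are finite and simple. The D3 reductions are the following two operations on a graph $G$. (D3a) Let $p,q,r$ be three vertices of degree three that induce a triangle in $G$ and whose neighbors outside $\{p,q,r\}$ are three distinct vertices; replace $p,q,r$ by a single new vertex adjacent to exactly those three outside neighbors. (D3b) Let $p,q,r$ be three vertices of degree three that induce a path with middle vertex $q$, and suppose there is a single vertex $s$ adjacent to all three of $p,q,r$; delete $q$ and add a new edge from $p$ to $r$. A graph is D3-reducible if it can be transformed into a graph isomorphic to $K_4$ by a finite sequence of D3 reductions. *)

theory Defs
  imports Main
begin

text \<open>
  A graph is a pair of a vertex set and a set of edges, an edge being the two-element set
  of its ends. Only graphs satisfying \<open>simple_graph\<close> below are meant.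
\<close>

type_synonym 'a ugraph = "'a set \<times> 'a set set"

abbreviation verts :: "'a ugraph \<Rightarrow> 'a set" where
  "verts G \<equiv> fst G"

abbreviation edges :: "'a ugraph \<Rightarrow> 'a set set" where
  "edges G \<equiv> snd G"

definition simple_graph :: "'a ugraph \<Rightarrow> bool" where
  "simple_graph G \<longleftrightarrow> finite (verts G) \<and> (\<forall>e \<in> edges G. e \<subseteq> verts G \<and> card e = 2)"

definition adj :: "'a ugraph \<Rightarrow> 'a \<Rightarrow> 'a \<Rightarrow> bool" where
  "adj G x y \<longleftrightarrow> {x, y} \<in> edges G"

definition nbrs :: "'a ugraph \<Rightarrow> 'a \<Rightarrow> 'a set" where
  "nbrs G x = {y. adj G x y}"

definition degree :: "'a ugraph \<Rightarrow> 'a \<Rightarrow> nat" where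
  "degree G x = card (nbrs G x)"

definition delete_verts :: "'a ugraph \<Rightarrow> 'a set \<Rightarrow> 'a ugraph" where
  "delete_verts G X = (verts G - X, {e \<in> edges G. e \<inter> X = {}})"

definition delete_edge :: "'a ugraph \<Rightarrow> 'a \<Rightarrow> 'a \<Rightarrow> 'a ugraph" where
  "delete_edge G u v = (verts G, edges G - {{u, v}})"

definition graph_connected :: "'a ugraph \<Rightarrow> bool" where
  "graph_connected G \<longleftrightarrow> verts G \<noteq> {} \<and> (\<forall>x \<in> verts G. \<forall>y \<in> verts G. (adj G)\<^sup>*\<^sup>* x y)"

definition vertex_connected :: "nat \<Rightarrow> 'a ugraph \<Rightarrow> bool" where
  "vertex_connected k G \<longleftrightarrow>
     card (verts G) > k \<and>
     (\<forall>X \<subseteq> verts G. card X < k \<longrightarrow> graph_connected (delete_verts G X))"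

definition isomorphic :: "'a ugraph \<Rightarrow> 'b ugraph \<Rightarrow> bool" where
  "isomorphic G H \<longleftrightarrow>
     (\<exists>f. bij_betw f (verts G) (verts H) \<and> (\<lambda>e. f ` e) ` edges G = edges H)"

definition complete_graph :: "nat \<Rightarrow> nat ugraph" where
  "complete_graph n = ({..<n}, {e. e \<subseteq> {..<n} \<and> card e = 2})"

text \<open>
  The new vertex \<open>w\<close> only has to differ from the vertices that remain, so one of the
  names \<open>p, q, r\<close> may be reused. This keeps the reduction available even when the vertices of
  \<open>G\<close> exhaust the type, and does not affect the result up to isomorphism.
\<close>

definition D3a :: "'a ugraph \<Rightarrow> 'a ugraph \<Rightarrow> bool" where
  "D3a G H \<longleftrightarrow> (\<exists>p q r a b c w.
     {p, q, r} \<subseteq> verts G \<and> distinct [p, q, r] \<and>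
     degree G p = 3 \<and> degree G q = 3 \<and> degree G r = 3 \<and>
     adj G p q \<and> adj G q r \<and> adj G p r \<and>
     nbrs G p - {p, q, r} = {a} \<and> nbrs G q - {p, q, r} = {b} \<and> nbrs G r - {p, q, r} = {c} \<and>
     distinct [a, b, c] \<and>
     w \<notin> verts G - {p, q, r} \<and>
     H = (insert w (verts G - {p, q, r}),
          edges (delete_verts G {p, q, r}) \<union> {{w, a}, {w, b}, {w, c}}))"

definition D3b :: "'a ugraph \<Rightarrow> 'a ugraph \<Rightarrow> bool" where
  "D3b G H \<longleftrightarrow> (\<exists>p q r s.
     {p, q, r} \<subseteq> verts G \<and> distinct [p, q, r] \<and>
     degree G p = 3 \<and> degree G q = 3 \<and> degree G r = 3 \<and>
     adj G p q \<and> adj G q r \<and> \<not> adj G p r \<and>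
     adj G s p \<and> adj G s q \<and> adj G s r \<and>
     H = (verts G - {q}, edges (delete_verts G {q}) \<union> {{p, r}}))"

definition D3_step :: "'a ugraph \<Rightarrow> 'a ugraph \<Rightarrow> bool" where
  "D3_step G H \<longleftrightarrow> D3a G H \<or> D3b G H"

definition D3_reducible :: "'a ugraph \<Rightarrow> bool" where
  "D3_reducible G \<longleftrightarrow> (\<exists>H. D3_step\<^sup>*\<^sup>* G H \<and> isomorphic H (complete_graph 4))"

end

theory Submission imports Defs begin

text \<open>
  If \<open>G - uv\<close> is 3-connected then all its degrees are at least three, so neither \<open>u\<close> nor \<open>v\<close>
  has degree three in \<open>G\<close>. Hence \<open>uv\<close> misses \<open>p, q, r\<close> in any D3 reduction from \<open>G\<close> to \<open>H\<close>, and
  the same reduction leads from \<open>G - uv\<close> to \<open>H - uv\<close>. D3 reductions preserve 3-connectivity, so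
  \<open>H - uv\<close> is 3-connected. Iterating, one reaches \<open>K\<^sub>4\<close> minus an edge, which has a vertex of
  degree two.
\<close>

section \<open>Adjacency and neighbourhoods under deletion of vertices and edges\<close>

lemma adj_commute: "adj G x y \<longleftrightarrow> adj G y x"
  by (simp add: adj_def insert_commute)

lemma simple_graph_adj:
  assumes "simple_graph G" "adj G x y"
  shows "x \<in> verts G" "y \<in> verts G" "x \<noteq> y"
  using assms unfolding simple_graph_def adj_def by fastforce+

lemma adj_delete_verts: "adj (delete_verts G X) x y \<longleftrightarrow> adj G x y \<and> x \<notin> X \<and> y \<notin> X"
  by (auto simp: adj_def delete_verts_def)

lemma adj_delete_edge: "adj (delete_edge G u v) x y \<longleftrightarrow> adj G x y \<and> {x, y} \<noteq> {u, v}"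
  by (auto simp: adj_def delete_edge_def)

lemma verts_delete_verts [simp]: "verts (delete_verts G X) = verts G - X"
  by (simp add: delete_verts_def)

lemma verts_delete_edge [simp]: "verts (delete_edge G u v) = verts G"
  by (simp add: delete_edge_def)

lemma simple_graph_delete_verts: "simple_graph G \<Longrightarrow> simple_graph (delete_verts G X)"
  by (auto simp: simple_graph_def delete_verts_def)

lemma simple_graph_delete_edge: "simple_graph G \<Longrightarrow> simple_graph (delete_edge G u v)"
  by (auto simp: simple_graph_def delete_edge_def)

lemma nbrs_subset: "simple_graph G \<Longrightarrow> nbrs G x \<subseteq> verts G - {x}"
  using simple_graph_adj[of G x] by (auto simp: nbrs_def)

lemma finite_nbrs: "simple_graph G \<Longrightarrow> finite (nbrs G x)"
  by (rule finite_subset[OF nbrs_subset]) (auto simp: simple_graph_def)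

section \<open>Connectivity in terms of unions of components\<close>

text \<open>For simple graphs these are the unions of connected components. They replace paths
  below: to carry connectivity from one graph to another it is enough to translate a vertex
  set.\<close>

definition adj_closed :: "'a ugraph \<Rightarrow> 'a set \<Rightarrow> bool" where
  "adj_closed G A \<longleftrightarrow> A \<subseteq> verts G \<and> (\<forall>x \<in> A. \<forall>y \<in> verts G. adj G x y \<longrightarrow> y \<in> A)"

text \<open>A closed set contains everything reachable from any of its vertices, and the set of
  vertices reachable from \<open>x\<close> is itself closed.\<close>

lemma graph_connected_iff_adj_closed:
  assumes "simple_graph G"
  shows "graph_connected G \<longleftrightarrow>
    verts G \<noteq> {} \<and> (\<forall>A. adj_closed G A \<longrightarrow> A \<noteq> {} \<longrightarrow> A = verts G)"
proof (intro iffI conjI allI impI)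
  assume con: "graph_connected G"
  then show "verts G \<noteq> {}" by (simp add: graph_connected_def)
  fix A assume A: "adj_closed G A" "A \<noteq> {}"
  then obtain x where x: "x \<in> A" "x \<in> verts G" by (auto simp: adj_closed_def)
  have "y \<in> A" if "y \<in> verts G" for y
  proof -
    have "(adj G)\<^sup>*\<^sup>* x y" using con x that by (simp add: graph_connected_def)
    then show ?thesis
      by (induction rule: rtranclp_induct)
        (use A x simple_graph_adj[OF assms] in \<open>auto simp: adj_closed_def\<close>)
  qed
  then show "A = verts G" using A by (auto simp: adj_closed_def)
next
  assume *: "verts G \<noteq> {} \<and> (\<forall>A. adj_closed G A \<longrightarrow> A \<noteq> {} \<longrightarrow> A = verts G)"
  have "(adj G)\<^sup>*\<^sup>* x y" if "x \<in> verts G" "y \<in> verts G" for x y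
  proof -
    let ?A = "{z \<in> verts G. (adj G)\<^sup>*\<^sup>* x z}"
    have "adj_closed G ?A" by (auto simp: adj_closed_def intro: rtranclp.rtrancl_into_rtrancl)
    moreover have "?A \<noteq> {}" using that by auto
    ultimately have "?A = verts G" using * by blast
    then show ?thesis using that by blast
  qed
  with * show "graph_connected G" by (simp add: graph_connected_def)
qed

text \<open>The condition that \<open>G - X\<close> is nonempty disappears, since a set of fewer
  than \<open>k\<close> vertices cannot exhaust more than \<open>k\<close> vertices.\<close>

lemma vertex_connected_iff_adj_closed:
  assumes "simple_graph G"
  shows "vertex_connected k G \<longleftrightarrow> card (verts G) > k \<and>
    (\<forall>X A. X \<subseteq> verts G \<longrightarrow> card X < k \<longrightarrow> adj_closed (delete_verts G X) A \<longrightarrow> A \<noteq> {} \<longrightarrow>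
      A = verts G - X)"
proof -
  have "verts G - X \<noteq> {}" if "card (verts G) > k" "X \<subseteq> verts G" "card X < k" for X
    using that by auto
  then show ?thesis
    unfolding vertex_connected_def
      graph_connected_iff_adj_closed[OF simple_graph_delete_verts[OF assms]] verts_delete_verts
    by (metis)
qed

text \<open>The form in which connectivity of \<open>G\<close> is applied: closure of
  \<open>A\<close> is checked along edges of \<open>G\<close> itself, leaving out only the ends in
  \<open>X\<close>.\<close>

lemma vertex_connected_adj_closedD:
  assumes "simple_graph G" "vertex_connected k G" "X \<subseteq> verts G" "card X < k"
    "A \<subseteq> verts G - X" "A \<noteq> {}"
    "\<And>x y. x \<in> A \<Longrightarrow> adj G x y \<Longrightarrow> y \<notin> X \<Longrightarrow> y \<in> A"
  shows "A = verts G - X"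
proof -
  have "adj_closed (delete_verts G X) A"
    using assms by (auto simp: adj_closed_def adj_delete_verts)
  then show ?thesis using assms vertex_connected_iff_adj_closed by blast
qed

section \<open>Degrees in highly connected graphs\<close>

text \<open>Removing the neighbours of \<open>x\<close> isolates \<open>x\<close>. If there were
  fewer than \<open>k\<close> of them, then \<open>x\<close> and its neighbours would be all of
  \<open>G\<close>, which is at most \<open>k\<close> vertices.\<close>

lemma vertex_connected_degree:
  assumes "simple_graph G" "vertex_connected k G" "x \<in> verts G"
  shows "k \<le> degree G x"
proof (rule ccontr)
  assume "\<not> k \<le> degree G x"
  then have less: "card (nbrs G x) < k" by (simp add: degree_def)
  have sub: "nbrs G x \<subseteq> verts G - {x}" by (rule nbrs_subset[OF assms(1)])
  have "{x} = verts G - nbrs G x"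
    by (rule vertex_connected_adj_closedD[OF assms(1,2)])
      (use less sub assms(3) in \<open>auto simp: nbrs_def\<close>)
  then have "verts G = insert x (nbrs G x)" using sub assms(3) by blast
  then have "card (verts G) \<le> Suc (card (nbrs G x))"
    by (metis card_insert_le_m1 card_insert_if finite_nbrs[OF assms(1)] le_SucI order_refl)
  with less assms(2) show False by (simp add: vertex_connected_def)
qed

lemma degree_delete_edge_less:
  assumes "simple_graph G" "{u, v} \<in> edges G"
  shows "degree (delete_edge G u v) u < degree G u"
proof -
  have "nbrs (delete_edge G u v) u \<subseteq> nbrs G u - {v}" "v \<in> nbrs G u"
    using assms(2) by (auto simp: nbrs_def adj_delete_edge) (simp add: adj_def)
  then have "nbrs (delete_edge G u v) u \<subset> nbrs G u" by blast
  then show ?thesis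
    unfolding degree_def by (rule psubset_card_mono[OF finite_nbrs[OF assms(1)]])
qed

text \<open>Each end has degree at least \<open>k\<close> after the deletion, which costs it a
  neighbour. With \<open>k = 3\<close> this keeps \<open>u\<close> and \<open>v\<close> away from
  the degree-three vertices of a reduction, and it settles the four-vertex case.\<close>

lemma delete_edge_connected_degree:
  assumes "simple_graph G" "{u, v} \<in> edges G" "vertex_connected k (delete_edge G u v)"
  shows "k < degree G u" "k < degree G v"
proof -
  \<comment> \<open>Stated for an arbitrary naming of the two ends, so that it serves for
    \<open>u\<close> and \<open>v\<close> alike.\<close>
  have *: "k < degree G x" if "{x, y} = {u, v}" for x y
  proof -
    have e: "{x, y} \<in> edges G" using assms(2) that by simp
    have "x \<in> verts G" using e simple_graph_adj[OF assms(1)] by (auto simp: adj_def)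
    moreover have "vertex_connected k (delete_edge G x y)"
      using assms(3) that by (simp add: delete_edge_def)
    ultimately have "k \<le> degree (delete_edge G x y) x"
      using vertex_connected_degree[OF simple_graph_delete_edge[OF assms(1)]] by simp
    also have "\<dots> < degree G x" by (rule degree_delete_edge_less[OF assms(1) e])
    finally show ?thesis .
  qed
  show "k < degree G u" by (rule *[of u v]) simp
  show "k < degree G v" by (rule *[of v u]) auto
qed

lemma degree_less_card_verts:
  assumes "simple_graph G" "x \<in> verts G"
  shows "degree G x < card (verts G)"
proof -
  have "nbrs G x \<subset> verts G" using nbrs_subset[OF assms(1)] assms(2) by blast
  then show ?thesis
    using assms(1) by (simp add: degree_def simple_graph_def psubset_card_mono)
qed

section \<open>D3 reductions keep graphs simple and commute with deleting an edge\<close>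

lemma D3a_simple_graph:
  assumes "simple_graph G" "D3a G H" shows "simple_graph H"
proof -
  obtain p q r a b c w where
    nb: "nbrs G p - {p, q, r} = {a}" "nbrs G q - {p, q, r} = {b}" "nbrs G r - {p, q, r} = {c}"
    and w: "w \<notin> verts G - {p, q, r}"
    and H: "H = (insert w (verts G - {p, q, r}),
          edges (delete_verts G {p, q, r}) \<union> {{w, a}, {w, b}, {w, c}})"
    using assms(2) unfolding D3a_def by (elim exE conjE) (rule that, assumption+)
  have "a \<in> nbrs G p - {p, q, r}" "b \<in> nbrs G q - {p, q, r}" "c \<in> nbrs G r - {p, q, r}"
    unfolding nb by simp_all
  then have "a \<in> verts G - {p, q, r}" "b \<in> verts G - {p, q, r}" "c \<in> verts G - {p, q, r}"
    using nbrs_subset[OF assms(1)] by blast+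
  moreover from this w have "w \<noteq> a" "w \<noteq> b" "w \<noteq> c" by auto
  ultimately show ?thesis
    using assms(1) unfolding H simple_graph_def delete_verts_def by auto
qed

lemma D3b_simple_graph:
  assumes "simple_graph G" "D3b G H" shows "simple_graph H"
  using assms unfolding D3b_def simple_graph_def delete_verts_def by fastforce

lemma D3_step_simple_graph: "simple_graph G \<Longrightarrow> D3_step G H \<Longrightarrow> simple_graph H"
  unfolding D3_step_def using D3a_simple_graph D3b_simple_graph by blast

lemma nbrs_delete_edge: "x \<notin> {u, v} \<Longrightarrow> nbrs (delete_edge G u v) x = nbrs G x"
  by (auto simp: nbrs_def adj_delete_edge)

text \<open>The ends of \<open>uv\<close> do not have degree three, so they avoid the triangle,
  whose neighbourhoods are therefore unchanged by the deletion. The same witnesses work;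
  \<open>u\<close> or \<open>v\<close> may be among \<open>a, b, c\<close>.\<close>

lemma D3a_delete_edge:
  assumes "simple_graph G" "D3a G H" "{u, v} \<in> edges G" "degree G u \<noteq> 3" "degree G v \<noteq> 3"
  shows "D3a (delete_edge G u v) (delete_edge H u v) \<and> {u, v} \<in> edges H"
proof -
  obtain p q r a b c w where
    G: "{p, q, r} \<subseteq> verts G" "distinct [p, q, r]"
      "degree G p = 3" "degree G q = 3" "degree G r = 3"
      "adj G p q" "adj G q r" "adj G p r"
      "nbrs G p - {p, q, r} = {a}" "nbrs G q - {p, q, r} = {b}" "nbrs G r - {p, q, r} = {c}"
      "distinct [a, b, c]"
    and w: "w \<notin> verts G - {p, q, r}"
    and H: "H = (insert w (verts G - {p, q, r}),
          edges (delete_verts G {p, q, r}) \<union> {{w, a}, {w, b}, {w, c}})"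
    using assms(2) unfolding D3a_def by (elim exE conjE) (rule that, assumption+)
  have uv: "u \<notin> {p, q, r}" "v \<notin> {p, q, r}" using G assms by auto
  then have pqr: "p \<notin> {u, v}" "q \<notin> {u, v}" "r \<notin> {u, v}" by auto
  have "u \<in> verts G" "v \<in> verts G"
    using assms(3) simple_graph_adj[OF assms(1)] by (auto simp: adj_def)
  \<comment> \<open>The name \<open>w\<close> may be reused from the triangle, but \<open>u\<close>
    and \<open>v\<close> survive the reduction, so no new edge at \<open>w\<close> can be
    \<open>uv\<close>.\<close>
  with uv w have "w \<notin> {u, v}" by auto
  then have e: "{w, x} \<noteq> {u, v}" for x by blast
  have *: "delete_edge H u v = (insert w (verts G - {p, q, r}),
      edges (delete_verts (delete_edge G u v) {p, q, r}) \<union> {{w, a}, {w, b}, {w, c}})"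
    using e unfolding H delete_edge_def delete_verts_def by auto
  have "D3a (delete_edge G u v) (delete_edge H u v)"
    unfolding D3a_def degree_def *
    apply (rule exI[of _ p], rule exI[of _ q], rule exI[of _ r], rule exI[of _ a],
        rule exI[of _ b], rule exI[of _ c], rule exI[of _ w])
    unfolding nbrs_delete_edge[OF pqr(1)] nbrs_delete_edge[OF pqr(2)] nbrs_delete_edge[OF pqr(3)]
    using G w pqr unfolding degree_def adj_delete_edge verts_delete_edge
    by auto
  moreover have "{u, v} \<in> edges H" using assms(3) uv by (auto simp: H delete_verts_def)
  ultimately show ?thesis by blast
qed

text \<open>As for the triangle reduction, the witnesses carry over. The vertex \<open>s\<close> may
  be an end of \<open>uv\<close>, but its edges to \<open>p, q, r\<close> are not
  \<open>uv\<close>.\<close>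

lemma D3b_delete_edge:
  assumes "D3b G H" "{u, v} \<in> edges G" "degree G u \<noteq> 3" "degree G v \<noteq> 3"
  shows "D3b (delete_edge G u v) (delete_edge H u v) \<and> {u, v} \<in> edges H"
proof -
  obtain p q r s where
    G: "{p, q, r} \<subseteq> verts G" "distinct [p, q, r]"
      "degree G p = 3" "degree G q = 3" "degree G r = 3"
      "adj G p q" "adj G q r" "\<not> adj G p r" "adj G s p" "adj G s q" "adj G s r"
    and H: "H = (verts G - {q}, edges (delete_verts G {q}) \<union> {{p, r}})"
    using assms(1) unfolding D3b_def by (elim exE conjE) (rule that, assumption+)
  have uv: "u \<notin> {p, q, r}" "v \<notin> {p, q, r}" using G assms by auto
  then have pqr: "p \<notin> {u, v}" "q \<notin> {u, v}" "r \<notin> {u, v}" by auto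
  then have "{p, r} \<noteq> {u, v}" by blast
  then have *: "delete_edge H u v =
      (verts G - {q}, edges (delete_verts (delete_edge G u v) {q}) \<union> {{p, r}})"
    unfolding H delete_edge_def delete_verts_def by auto
  have "D3b (delete_edge G u v) (delete_edge H u v)"
    unfolding D3b_def degree_def *
    apply (rule exI[of _ p], rule exI[of _ q], rule exI[of _ r], rule exI[of _ s])
    unfolding nbrs_delete_edge[OF pqr(1)] nbrs_delete_edge[OF pqr(2)] nbrs_delete_edge[OF pqr(3)]
    using G pqr unfolding degree_def adj_delete_edge verts_delete_edge
    by auto
  moreover have "{u, v} \<in> edges H" using assms(2) uv by (auto simp: H delete_verts_def)
  ultimately show ?thesis by blast
qed

lemma D3_step_delete_edge:
  assumes "simple_graph G" "D3_step G H" "{u, v} \<in> edges G" "degree G u \<noteq> 3" "degree G v \<noteq> 3"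
  shows "D3_step (delete_edge G u v) (delete_edge H u v) \<and> {u, v} \<in> edges H"
  using assms(2) D3a_delete_edge[OF assms(1) _ assms(3-5)] D3b_delete_edge[OF _ assms(3-5)]
  unfolding D3_step_def by metis

section \<open>D3 reductions preserve 3-connectivity\<close>

text \<open>\<open>H\<close> is \<open>G\<close> with the triangle contracted to \<open>w\<close>. A
  cut of \<open>H\<close> avoiding \<open>w\<close> is already a cut of \<open>G\<close>. A cut
  containing \<open>w\<close> leaves a side meeting at most one of \<open>a, b, c\<close>, and in
  the cut a single triangle vertex can then replace \<open>w\<close>.\<close>

lemma D3a_vertex_connected:
  assumes sG: "simple_graph G" and D: "D3a G H" and con: "vertex_connected 3 G"
  shows "vertex_connected 3 H"
proof -
  obtain p q r a b c w where
    G: "{p, q, r} \<subseteq> verts G" "distinct [p, q, r]"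
    and adj3: "adj G p q" "adj G q r" "adj G p r"
    and nb: "nbrs G p - {p, q, r} = {a}" "nbrs G q - {p, q, r} = {b}" "nbrs G r - {p, q, r} = {c}"
    and abc: "distinct [a, b, c]"
    and w: "w \<notin> verts G - {p, q, r}"
    and H: "H = (insert w (verts G - {p, q, r}),
          edges (delete_verts G {p, q, r}) \<union> {{w, a}, {w, b}, {w, c}})"
    using D unfolding D3a_def by (elim exE conjE) (rule that, assumption+)
  let ?W = "verts G - {p, q, r}"
  have sH: "simple_graph H" by (rule D3a_simple_graph[OF sG D])
  have finW: "finite ?W" using sG by (simp add: simple_graph_def)
  have VH: "verts H = insert w ?W" by (simp add: H)
  have "a \<in> nbrs G p - {p, q, r}" "b \<in> nbrs G q - {p, q, r}" "c \<in> nbrs G r - {p, q, r}"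
    unfolding nb by simp_all
  then have abcW: "a \<in> ?W" "b \<in> ?W" "c \<in> ?W"
    using nbrs_subset[OF sG] by blast+
  have adjp: "adj G p y \<longleftrightarrow> y = a" "adj G q y \<longleftrightarrow> y = b" "adj G r y \<longleftrightarrow> y = c"
    "adj G y p \<longleftrightarrow> y = a" "adj G y q \<longleftrightarrow> y = b" "adj G y r \<longleftrightarrow> y = c"
    if "y \<in> ?W" for y
    using nb that unfolding nbrs_def adj_commute[of G y] by auto
  have adjW: "adj H x y \<longleftrightarrow> adj G x y" if "x \<in> ?W" "y \<in> ?W" for x y
    using that w by (auto simp: H adj_def delete_verts_def doubleton_eq_iff)
  have adjw: "adj H w y" "adj H y w" if "y \<in> {a, b, c}" for y
    using that by (auto simp: H adj_def insert_commute)
  have "card (verts H) > 3"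
  proof -
    have "w \<notin> {a, b, c}" using abcW w by blast
    then have "card {w, a, b, c} = 4" using abc by simp
    moreover have "card {w, a, b, c} \<le> card (verts H)"
      by (rule card_mono) (use finW abcW VH in auto)
    ultimately show ?thesis by simp
  qed
  moreover have "A = verts H - X" if X: "X \<subseteq> verts H" "card X < 3"
    and clos: "adj_closed (delete_verts H X) A" and ne: "A \<noteq> {}" for X A
  proof -
    have AH: "A \<subseteq> verts H - X" using clos by (simp add: adj_closed_def)
    have cl: "y \<in> A" if "x \<in> A" "y \<in> verts H - X" "adj H x y" for x y
      using that clos AH by (auto simp: adj_closed_def adj_delete_verts)
    show ?thesis
    proof (cases "w \<in> X")
      case False
      \<comment> \<open>The preimage of \<open>A\<close> under the contraction of the triangle to
        \<open>w\<close>.\<close>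
      define B where "B = A \<inter> ?W \<union> (if w \<in> A then {p, q, r} else {})"
      have XW: "X \<subseteq> ?W" using X False VH by auto
      have "B = verts G - X"
      proof (rule vertex_connected_adj_closedD[OF sG con])
        show "X \<subseteq> verts G" "card X < 3" using XW X by auto
        show "B \<subseteq> verts G - X" using AH XW G by (auto simp: B_def)
        show "B \<noteq> {}" using ne AH VH by (auto simp: B_def)
        fix x y assume x: "x \<in> B" and xy: "adj G x y" and y: "y \<notin> X"
        have yG: "y \<in> verts G" using xy simple_graph_adj[OF sG] by blast
        have wX: "w \<in> verts H - X" using False VH by simp
        consider "x \<in> ?W" "y \<in> ?W" | "x \<in> ?W" "y \<notin> ?W" | "x \<notin> ?W" "y \<in> ?W"
          | "x \<notin> ?W" "y \<notin> ?W" by blast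
        then show "y \<in> B"
        proof cases
          case 1
          then have "x \<in> A" using x by (auto simp: B_def split: if_splits)
          then show ?thesis using cl[of x y] 1 xy y adjW VH by (simp add: B_def)
        next
          case 2
          then have "x \<in> A" using x by (auto simp: B_def split: if_splits)
          moreover have "x \<in> {a, b, c}" using 2 xy yG adjp(4-6)[of x] by auto
          ultimately have "w \<in> A" using cl[of x w] adjw wX by simp
          then show ?thesis using 2 yG by (auto simp: B_def)
        next
          case 3
          then have "w \<in> A" "x \<in> {p, q, r}" using x by (auto simp: B_def split: if_splits)
          moreover from this have "y \<in> {a, b, c}" using 3 xy adjp(1-3)[of y] by auto
          ultimately have "y \<in> A" using cl[of w y] adjw 3 y VH by simp
          then show ?thesis using 3 by (simp add: B_def)
        next
          case 4
          then show ?thesis using x yG by (auto simp: B_def split: if_splits)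
        qed
      qed
      \<comment> \<open>\<open>X\<close> misses the triangle, so the triangle lies in
        \<open>B\<close>, which happens only if \<open>w\<close> is in \<open>A\<close>.\<close>
      moreover from this have "w \<in> A"
        using G XW by (auto simp: B_def split: if_splits)
      ultimately show ?thesis using AH VH XW False unfolding B_def by auto
    next
      case True
      define Y where "Y = X - {w}"
      have YW: "Y \<subseteq> ?W" using X VH by (auto simp: Y_def)
      have finX: "finite X" using X(1) finW VH by (simp add: finite_subset)
      then have cardY: "card Y < 2" using X True by (simp add: Y_def)
      have VX: "verts H - X = ?W - Y" using True w VH by (auto simp: Y_def)
      \<comment> \<open>A union of components meeting only one of \<open>a, b, c\<close> would be cut off in \<open>G\<close>
        by \<open>Y\<close> and the neighbour \<open>z\<close> of that vertex in the triangle.\<close>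
      have sep: False if D: "D \<subseteq> ?W - Y" "D \<noteq> {}"
        and clD: "\<And>x y. x \<in> D \<Longrightarrow> y \<in> ?W - Y \<Longrightarrow> adj G x y \<Longrightarrow> y \<in> D"
        and z: "z \<in> {p, q, r}"
        and zD: "\<And>x y. x \<in> D \<Longrightarrow> y \<in> {p, q, r} \<Longrightarrow> adj G x y \<Longrightarrow> y = z" for D z
      proof -
        have "D = verts G - insert z Y"
        proof (rule vertex_connected_adj_closedD[OF sG con])
          show "insert z Y \<subseteq> verts G" using z YW G by auto
          have "card (insert z Y) \<le> Suc (card Y)"
            by (metis Y_def card_insert_if finX finite_Diff le_SucI order_refl)
          then show "card (insert z Y) < 3" using cardY by simp
          show "D \<subseteq> verts G - insert z Y" "D \<noteq> {}" using D z by auto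
          fix x y assume "x \<in> D" "adj G x y" "y \<notin> insert z Y"
          then show "y \<in> D" using clD[of x y] zD[of x y] simple_graph_adj(2)[OF sG] by blast
        qed
        \<comment> \<open>The other triangle vertices lie neither in the cut nor in
          \<open>D\<close>, contradicting that \<open>D\<close> is everything outside the
          cut.\<close>
        moreover obtain z' where "z' \<in> {p, q, r}" "z' \<noteq> z" using G z by auto
        ultimately have "z' \<in> D" using G YW by auto
        then show False using D \<open>z' \<in> {p, q, r}\<close> by auto
      qed
      have few: False if "D \<subseteq> ?W - Y" "D \<noteq> {}"
        and "\<And>x y. x \<in> D \<Longrightarrow> y \<in> ?W - Y \<Longrightarrow> adj G x y \<Longrightarrow> y \<in> D"
        and D3: "a \<notin> D \<and> b \<notin> D \<or> a \<notin> D \<and> c \<notin> D \<or> b \<notin> D \<and> c \<notin> D" for D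
      proof -
        have DW: "x \<in> D \<Longrightarrow> x \<in> ?W" for x using that(1) by blast
        \<comment> \<open>For \<open>z\<close> take the triangle vertex attached to the one of
          \<open>a, b, c\<close> that \<open>D\<close> may still contain.\<close>
        from D3 consider "a \<notin> D" "b \<notin> D" | "a \<notin> D" "c \<notin> D" | "b \<notin> D" "c \<notin> D" by blast
        then show False
        proof cases
          case 1 show False by (rule sep[of D r]) (use that 1 adjp(4-6)[OF DW] in auto)
        next
          case 2 show False by (rule sep[of D q]) (use that 2 adjp(4-6)[OF DW] in auto)
        next
          case 3 show False by (rule sep[of D p]) (use that 3 adjp(4-6)[OF DW] in auto)
        qed
      qed
      \<comment> \<open>The other side of the cut; it is closed because adjacency is
        symmetric.\<close>
      define C where "C = ?W - Y - A"
      have AW: "A \<subseteq> ?W - Y" using AH VX by simp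
      have clA: "y \<in> A" if "x \<in> A" "y \<in> ?W - Y" "adj G x y" for x y
        using cl[of x y] that VX adjW AW by blast
      have clC: "y \<in> C" if "x \<in> C" "y \<in> ?W - Y" "adj G x y" for x y
        using clA[of y x] that adj_commute[of G] unfolding C_def by blast
      have "C = {}"
      proof (rule ccontr)
        assume "C \<noteq> {}"
        have "C \<subseteq> ?W - Y" "A \<inter> C = {}" by (auto simp: C_def)
        note Cfew = few[OF this(1) \<open>C \<noteq> {}\<close> clC]
        \<comment> \<open>Pigeonhole: two disjoint sets cannot each contain two of the three
          vertices \<open>a, b, c\<close>.\<close>
        consider "a \<notin> A \<and> b \<notin> A \<or> a \<notin> A \<and> c \<notin> A \<or> b \<notin> A \<and> c \<notin> A"
          | "a \<notin> C \<and> b \<notin> C \<or> a \<notin> C \<and> c \<notin> C \<or> b \<notin> C \<and> c \<notin> C"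
          using \<open>A \<inter> C = {}\<close> by blast
        then show False
        proof cases
          case 1 show False by (rule few[OF AW ne clA 1])
        next
          case 2 show False by (rule Cfew[OF _ _ _ 2])
        qed
      qed
      then show ?thesis using AW VX by (auto simp: C_def)
    qed
  qed
  ultimately show ?thesis using vertex_connected_iff_adj_closed[OF sH] by blast
qed

text \<open>\<open>H\<close> is \<open>G\<close> with the edge \<open>pq\<close> contracted:
  \<open>qr\<close> turns into \<open>pr\<close>, and \<open>qs\<close> becomes parallel to
  \<open>ps\<close>. So a cut \<open>X\<close> of \<open>H\<close> also serves as a cut of
  \<open>G\<close>, once \<open>q\<close> is put on the correct side.\<close>

lemma D3b_vertex_connected:
  assumes sG: "simple_graph G" and D: "D3b G H" and con: "vertex_connected 3 G"
  shows "vertex_connected 3 H"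
proof -
  obtain p q r s where
    G: "{p, q, r} \<subseteq> verts G" "distinct [p, q, r]"
      "degree G p = 3" "degree G q = 3" "degree G r = 3"
      "adj G p q" "adj G q r" "\<not> adj G p r" "adj G s p" "adj G s q" "adj G s r"
    and H: "H = (verts G - {q}, edges (delete_verts G {q}) \<union> {{p, r}})"
    using D unfolding D3b_def by (elim exE conjE) (rule that, assumption+)
  have sH: "simple_graph H" by (rule D3b_simple_graph[OF sG D])
  have finG: "finite (verts G)" using sG by (simp add: simple_graph_def)
  have VH: "verts H = verts G - {q}" by (simp add: H)
  have s: "s \<in> verts G" "s \<notin> {p, q, r}"
    using simple_graph_adj[OF sG G(9)] simple_graph_adj(3)[OF sG G(10)]
      simple_graph_adj(3)[OF sG G(11)] by simp_all
  have "{p, r, s} \<subseteq> nbrs G q" using G(6,7,10) adj_commute[of G] by (auto simp: nbrs_def)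
  moreover have "card {p, r, s} = 3" using G(2) s by auto
  ultimately have nq: "nbrs G q = {p, r, s}"
    using G(4) card_subset_eq[OF finite_nbrs[OF sG]] unfolding degree_def by metis
  have adjq: "adj G q y \<longleftrightarrow> y \<in> {p, r, s}" "adj G y q \<longleftrightarrow> y \<in> {p, r, s}" for y
    using nq adj_commute[of G y q] by (auto simp: nbrs_def)
  have adjH: "adj H x y" if "adj G x y" "x \<noteq> q" "y \<noteq> q" for x y
    using that by (auto simp: H adj_def delete_verts_def)
  have adjpr: "adj H p r" "adj H r p" by (auto simp: H adj_def insert_commute)
  have "card (verts H) > 3"
  proof -
    \<comment> \<open>The bound on \<open>verts G\<close> leaves only three vertices after losing
      \<open>q\<close>. A fourth one is the third neighbour of \<open>p\<close>, which is not
      \<open>r\<close> because the path is induced.\<close>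
    obtain p' where p': "p' \<in> nbrs G p" "p' \<notin> {q, s}"
    proof -
      have "card {q, s} < card (nbrs G p)" using G(3) s by (auto simp: degree_def)
      then have "\<not> nbrs G p \<subseteq> {q, s}" by (meson card_mono finite.intros leD)
      then show ?thesis using that by blast
    qed
    then have pp': "adj G p p'" by (simp add: nbrs_def)
    have "p' \<noteq> r" using pp' G(8) by blast
    moreover have "p' \<in> verts G" "p' \<noteq> p" using simple_graph_adj[OF sG pp'] by simp_all
    ultimately have sub: "{p, r, s, p'} \<subseteq> verts H" and "distinct [p, r, s, p']"
      using G(1,2) s p'(2) VH by auto
    then have c: "card {p, r, s, p'} = 4" by simp
    have "finite (verts H)" using finG VH by simp
    from card_mono[OF this sub] c show ?thesis by simp
  qed
  moreover have "A = verts H - X" if X: "X \<subseteq> verts H" "card X < 3"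
    and clos: "adj_closed (delete_verts H X) A" and ne: "A \<noteq> {}" for X A
  proof -
    have AH: "A \<subseteq> verts H - X" using clos by (simp add: adj_closed_def)
    have cl: "y \<in> A" if "x \<in> A" "y \<in> verts H - X" "adj H x y" for x y
      using that clos AH by (auto simp: adj_closed_def adj_delete_verts)
    have XG: "X \<subseteq> verts G" "q \<notin> X" using X VH by auto
    \<comment> \<open>\<open>H\<close> is \<open>G\<close> with \<open>q\<close> contracted into \<open>t = p\<close> or into \<open>t = r\<close>; if both are in \<open>X\<close>, then
      \<open>q\<close> is a leaf of \<open>G - X\<close> attached to \<open>t = s\<close>.\<close>
    have lift: ?thesis if t: "t \<in> {p, r, s}" "t \<notin> X"
      and tn: "\<And>y. y \<in> {p, r, s} \<Longrightarrow> y \<notin> X \<Longrightarrow> y \<noteq> t \<Longrightarrow> adj H t y \<and> adj H y t" for t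
    proof -
      \<comment> \<open>\<open>q\<close> goes to the side of its representative
        \<open>t\<close>.\<close>
      define B where "B = A \<union> (if t \<in> A then {q} else {})"
      have tH: "t \<in> verts H - X" using t G(1,2) s VH by auto
      have prsH: "y \<in> verts H" if "y \<in> {p, r, s}" for y using that G(1,2) s VH by auto
      have "B = verts G - X"
      proof (rule vertex_connected_adj_closedD[OF sG con XG(1) X(2)])
        show "B \<subseteq> verts G - X" using AH VH XG G(1) by (auto simp: B_def)
        show "B \<noteq> {}" using ne by (simp add: B_def)
        fix x y assume x: "x \<in> B" and xy: "adj G x y" and y: "y \<notin> X"
        have yG: "y \<in> verts G" using simple_graph_adj[OF sG xy] by blast
        consider "x = q" | "x \<noteq> q" "y = q" | "x \<noteq> q" "y \<noteq> q" by blast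
        then show "y \<in> B"
        proof cases
          case 1
          then have "t \<in> A" using x AH VH by (auto simp: B_def split: if_splits)
          moreover have "y \<in> {p, r, s}" using xy 1 adjq by blast
          ultimately have "y \<in> A" using cl[of t y] tn[of y] y prsH by blast
          then show ?thesis by (simp add: B_def)
        next
          case 2
          then have xA: "x \<in> A" using x by (auto simp: B_def split: if_splits)
          have "x \<in> {p, r, s}" using xy 2 adjq by blast
          then have "t \<in> A" using cl[of x t] tn[of x] xA tH AH by blast
          then show ?thesis using 2 by (simp add: B_def)
        next
          case 3
          then have "x \<in> A" using x by (auto simp: B_def split: if_splits)
          then show ?thesis using cl[of x y] adjH[OF xy] 3 y yG VH by (simp add: B_def)
        qed
      qed
      moreover have "q \<notin> A" using AH VH by auto
      ultimately have "A = verts G - X - {q}" by (auto simp: B_def split: if_splits)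
      then show ?thesis using VH by auto
    qed
    have adjs: "adj H s p" "adj H p s" "adj H s r" "adj H r s"
      using adjH[OF G(9)] adjH[OF G(11)] G(2) s adj_commute[of H] by auto
    consider "p \<notin> X" | "r \<notin> X" | "p \<in> X" "r \<in> X" by blast
    then show ?thesis
    proof cases
      case 1 show ?thesis by (rule lift[of p]) (use 1 adjs adjpr in auto)
    next
      case 2 show ?thesis by (rule lift[of r]) (use 2 adjs adjpr in auto)
    next
      case 3
      have "s \<notin> X"
      proof
        assume "s \<in> X"
        then have "card {p, r, s} \<le> card X"
          using 3 X finG VH by (intro card_mono) (auto intro: finite_subset)
        then show False using X \<open>card {p, r, s} = 3\<close> by simp
      qed
      \<comment> \<open>The adjacency condition on \<open>t\<close> is vacuous here, since
        \<open>p\<close> and \<open>r\<close> both lie in \<open>X\<close>.\<close>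
      show ?thesis by (rule lift[of s]) (use 3 \<open>s \<notin> X\<close> in auto)
    qed
  qed
  ultimately show ?thesis using vertex_connected_iff_adj_closed[OF sH] by blast
qed

lemma D3_step_vertex_connected:
  "simple_graph G \<Longrightarrow> D3_step G H \<Longrightarrow> vertex_connected 3 G \<Longrightarrow> vertex_connected 3 H"
  unfolding D3_step_def using D3a_vertex_connected D3b_vertex_connected by blast

section \<open>Induction along the reduction sequence\<close>

theorem theorem8:
  fixes G :: "'a ugraph" and u v :: 'a
  assumes "simple_graph G"
    and "D3_reducible G"
    and "{u, v} \<in> edges G"
  shows "\<not> vertex_connected 3 (delete_edge G u v)"
proof -
  obtain K where K: "D3_step\<^sup>*\<^sup>* G K" "isomorphic K (complete_graph 4)"
    using assms(2) unfolding D3_reducible_def by blast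
  have cardK: "card (verts K) = 4"
    using K(2) bij_betw_same_card unfolding isomorphic_def complete_graph_def by fastforce
  \<comment> \<open>The induction peels off the first reduction. The ends \<open>u\<close> and
    \<open>v\<close> stay fixed, as they keep their names; simplicity and \<open>uv\<close> being an
    edge are carried along as premises.\<close>
  from K(1) assms(1,3) show ?thesis
  proof (induction rule: converse_rtranclp_induct)
    case base
    have "u \<in> verts K" using base unfolding simple_graph_def by blast
    then have "degree K u < 4" using degree_less_card_verts[OF base(1)] cardK by metis
    \<comment> \<open>Four vertices allow degree at most three, whereas 3-connectivity without
      \<open>uv\<close> would force degree at least four at \<open>u\<close>.\<close>
    then show ?case using delete_edge_connected_degree(1)[OF base] by fastforce
  next
    case (step G H)
    show ?case
    proof
      assume con: "vertex_connected 3 (delete_edge G u v)"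
      have "degree G u \<noteq> 3" "degree G v \<noteq> 3"
        using delete_edge_connected_degree[OF step.prems con] by simp_all
      then have H: "D3_step (delete_edge G u v) (delete_edge H u v)" "{u, v} \<in> edges H"
        using D3_step_delete_edge[OF step.prems(1) step.hyps(1) step.prems(2)] by simp_all
      have "vertex_connected 3 (delete_edge H u v)"
        by (rule D3_step_vertex_connected[OF simple_graph_delete_edge[OF step.prems(1)] H(1) con])
      then show False using step.IH[OF D3_step_simple_graph[OF step.prems(1) step.hyps(1)] H(2)]
        by contradiction
    qed
  qed
qed

end
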